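(* Let $f:\mathbb{R}^N\to\mathbb{R}$ be strongly convex with parameters $(L,l)$ (relative to the starting point $\mathbf{x}^0$), with minimizer $\mathbf{x}^*$, and let $\rho\ge1$ be a constant. Let $\mathbf{x}^0,\mathbf{x}^1,\mathbf{x}^2,\ldots$ be a sequence generated by the algorithm CGSO (conjugate gradient with subspace optimization, with parameter $\rho$) for solving $\min_{\mathbf{x}\in\mathbb{R}^N}f(\mathbf{x})$, where every step satisfies $f(\mathbf{x}^{j+1})\le f(\mathbf{x}^j)-\frac{1}{2L}\|\nabla f(\mathbf{x}^j)\|^2$ and $\nabla f(\mathbf{x}^j)\ne0$ for all $j$. Suppose $m$ is an integer with $m\ge\left\lceil 8\rho\sqrt{L/l}\,\right\rceil$. Then for any integer $n\ge0$, $$v_f(\mathbf{x}^{(n+4)m})\le\frac12\,v_f(\mathbf{x}^{nm}).$$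
   Context: $\langle\cdot,\cdot\rangle$ is the Euclidean inner product, $\|\cdot\|$ the 2-norm; superscripts on vectors and on $\lambda,\alpha,\beta$ are iteration indices. $f$ is as smooth as needed to run the algorithm. Strong convexity: $f$ is strongly convex with parameters $(L,l)$, where $L,l>0$, if for all $\mathbf{x},\mathbf{y}$ in the level set $\{\mathbf{z}: f(\mathbf{z})\le f(\mathbf{x}^0)\}$, $$\|\nabla f(\mathbf{x})-\nabla f(\mathbf{y})\|\le L\|\mathbf{x}-\mathbf{y}\|,\qquad f(\mathbf{y})-f(\mathbf{x})\ge\langle\nabla f(\mathbf{x}),\mathbf{y}-\mathbf{x}\rangle+\frac{l}{2}\|\mathbf{y}-\mathbf{x}\|^2 .$$ Residual: $v_f(\mathbf{x})=f(\mathbf{x})-f(\mathbf{x}^* )$. Notation: $\mathbf{g}^j=\nabla f(\mathbf{x}^j)$ and $\lambda^j=\sqrt{(f(\mathbf{x}^j)-f(\mathbf{x}^{j+1}))/\|\mathbf{g}^j\|^2}$. For $p\ge p_l:=4$, the blocks of size $2^p$ are the groups of consecutive iterates $\mathbf{x}^{r},\ldots,\mathbf{x}^{r+2^p-1}$ with $r$ a nonnegative multiple of $2^p$; $m(j,p)$ is the largest multiple of $2^p$ that is $\le j$. Independence inequalities for the iterates $\mathbf{x}^r,\ldots,\mathbf{x}^{t}$: $$\text{(I1)}\quad \frac{f(\mathbf{x}^{t})-f(\mathbf{x}^r)}{4}\sum_{i=r}^{t}\lambda^i+\sum_{i=r}^{t}\lambda^i\langle\mathbf{g}^i,\mathbf{x}^i-\mathbf{x}^r\rangle<0,$$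 $$\text{(I2)}\quad \Big\|\sum_{i=r}^{t}\lambda^i\mathbf{g}^i\Big\|\le\rho\sqrt{\sum_{i=r}^{t}(\lambda^i)^2\|\mathbf{g}^i\|^2}.$$ Algorithm CGSO. It maintains a set $S\subset\{p_l,p_l+1,\ldots\}$ of the values of $p$ for which correction is currently active; initially $S=\emptyset$. For $j=0,1,2,\ldots$: 1. Compute the nonlinear conjugate gradient direction $\mathbf{d}^j=-\mathbf{g}^j+\beta^j\mathbf{d}^{j-1}$ (any variant, i.e. any rule for $\beta^j$; $\beta^j=0$ if $j=0$ or if $\mathbf{d}^{j-1}$ was discarded), and a step length $\alpha^j$ by a Wolfe line search along $\mathbf{d}^j$. 2. Verification of a trial step $\mathbf{s}$: the step passes if for every $p\in S$, (I1) and (I2) hold with starting point $\mathbf{x}^{m(j,p)}$ and with $\mathbf{x}^j+\mathbf{s}$ as the last iterate. If $\alpha^j\mathbf{d}^j$ passes (in particular if $S=\emptyset$), set $\mathbf{s}^j=\alpha^j\mathbf{d}^j$. Otherwise discard $\mathbf{d}^j$ and take a correction step $\mathbf{s}^j=B\mathbf{y}$ which passes verification. Here $B$ is the matrix whose columns are $\mathbf{g}^j$, $\mathbf{d}^j$ and, for each $p\in S$ with $r_p=m(j,p)$, $\mathbf{q}_p=\sum_{i=r_p}^{j-1}\lambda^i\mathbf{g}^i$ and $\mathbf{x}^j-\mathbf{x}^{r_p}$. The vector $\mathbf{y}$ is an (approximate) solution of $\min_{\mathbf{y}}f(\mathbf{x}^j+B\mathbf{y})$, computed by Newton's method with an iteration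 limit and, if that fails, by the ellipsoid method, run until verification passes. (At an exact subspace minimizer the new gradient $\mathbf{g}^{j+1}$ is orthogonal to all columns of $B$.) Verification is the device by which the algorithm enforces that, for each $p$ and each block of size $2^p$ throughout which $p\in S$, (I1) and (I2) hold for the complete block, i.e. with $r$ the first index of the block and $t=r+2^p-1$. 3. Set $\mathbf{x}^{j+1}=\mathbf{x}^j+\mathbf{s}^j$. 4. For each $p\ge p_l$ such that $2^p$ divides $j+1$ (so that the block $\mathbf{x}^{j+1-2^p},\ldots,\mathbf{x}^j$ has just been completed): if $p\in S$, remove $p$ from $S$; otherwise, if (I1) or (I2) fails for this block ($r=j+1-2^p$, $t=j$), add $p$ to $S$. Consequently, for each $p\ge p_l$, whenever (I1) or (I2) fails for a block of size $2^p$, correction for $p$ is active throughout the next block of size $2^p$, and both inequalities hold for that next block. *)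

theory Defs
  imports "HOL-Analysis.Analysis"
begin

text \<open>
  Throughout, \<open>f\<close> is the objective function, \<open>G\<close> its gradient map
  (\<open>GDERIV f z :> G z\<close> for all \<open>z\<close>) and \<open>x\<close> the sequence of iterates.
\<close>

definition strongly_convex ::
    "(real^'n \<Rightarrow> real) \<Rightarrow> (real^'n \<Rightarrow> real^'n) \<Rightarrow> real \<Rightarrow> real \<Rightarrow> real^'n \<Rightarrow> bool" where
  "strongly_convex f G L l x0 \<longleftrightarrow>
     L > 0 \<and> l > 0 \<and>
     (\<forall>u\<in>{z. f z \<le> f x0}. \<forall>w\<in>{z. f z \<le> f x0}.
        norm (G u - G w) \<le> L * norm (u - w) \<and>
        f w - f u \<ge> G u \<bullet> (w - u) + l / 2 * (norm (w - u))\<^sup>2)"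

definition residual :: "(real^'n \<Rightarrow> real) \<Rightarrow> real^'n \<Rightarrow> real^'n \<Rightarrow> real" where
  "residual f xstar z = f z - f xstar"

definition lam ::
    "(real^'n \<Rightarrow> real) \<Rightarrow> (real^'n \<Rightarrow> real^'n) \<Rightarrow> (nat \<Rightarrow> real^'n) \<Rightarrow> nat \<Rightarrow> real" where
  "lam f G x j = sqrt ((f (x j) - f (x (Suc j))) / (norm (G (x j)))\<^sup>2)"

text \<open>
  The two independence inequalities for the iterates with indices from \<open>r\<close> to \<open>t\<close>.
  The weights \<open>la\<close> are a separate argument: see \<open>passes\<close> below.
\<close>

definition I1 ::
    "(real^'n \<Rightarrow> real) \<Rightarrow> (real^'n \<Rightarrow> real^'n) \<Rightarrow> (nat \<Rightarrow> real) \<Rightarrow> (nat \<Rightarrow> real^'n)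
      \<Rightarrow> nat \<Rightarrow> nat \<Rightarrow> bool" where
  "I1 f G la x r t \<longleftrightarrow>
     (f (x t) - f (x r)) / 4 * (\<Sum>i=r..t. la i)
       + (\<Sum>i=r..t. la i * (G (x i) \<bullet> (x i - x r))) < 0"

definition I2 ::
    "(real^'n \<Rightarrow> real^'n) \<Rightarrow> real \<Rightarrow> (nat \<Rightarrow> real) \<Rightarrow> (nat \<Rightarrow> real^'n)
      \<Rightarrow> nat \<Rightarrow> nat \<Rightarrow> bool" where
  "I2 G \<rho> la x r t \<longleftrightarrow>
     norm (\<Sum>i=r..t. la i *\<^sub>R G (x i))
       \<le> \<rho> * sqrt (\<Sum>i=r..t. (la i)\<^sup>2 * (norm (G (x i)))\<^sup>2)"

definition independent ::
    "(real^'n \<Rightarrow> real) \<Rightarrow> (real^'n \<Rightarrow> real^'n) \<Rightarrow> real \<Rightarrow> (nat \<Rightarrow> real) \<Rightarrow> (nat \<Rightarrow> real^'n)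
      \<Rightarrow> nat \<Rightarrow> nat \<Rightarrow> bool" where
  "independent f G \<rho> la x r t \<longleftrightarrow> I1 f G la x r t \<and> I2 G \<rho> la x r t"

text \<open>The largest multiple of \<open>2 ^ p\<close> that is at most \<open>j\<close>.\<close>

definition block_start :: "nat \<Rightarrow> nat \<Rightarrow> nat" where
  "block_start j p = 2 ^ p * (j div 2 ^ p)"

text \<open>
  Verification of the trial step \<open>s\<close> at iteration \<open>j\<close>, with \<open>P\<close> the set of active block
  exponents: the inequalities are evaluated with \<open>x j + s\<close> in place of the iterate of index
  \<open>j + 1\<close>, which is the last one. This replacement determines the weight of index \<open>j\<close>; the
  weight of index \<open>j + 1\<close> would involve the iterate of index \<open>j + 2\<close>, which does not
  exist yet, so the value \<open>\<mu>\<close> used for it is an argument.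
\<close>

definition passes ::
    "(real^'n \<Rightarrow> real) \<Rightarrow> (real^'n \<Rightarrow> real^'n) \<Rightarrow> real \<Rightarrow> real \<Rightarrow> (nat \<Rightarrow> real^'n)
      \<Rightarrow> nat set \<Rightarrow> nat \<Rightarrow> real^'n \<Rightarrow> bool" where
  "passes f G \<rho> \<mu> x P j s \<longleftrightarrow>
     (\<forall>p\<in>P. let x' = x(Suc j := x j + s); la = (lam f G x')(Suc j := \<mu>)
            in independent f G \<rho> la x' (block_start j p) (Suc j))"

definition wolfe ::
    "(real^'n \<Rightarrow> real) \<Rightarrow> (real^'n \<Rightarrow> real^'n) \<Rightarrow> real \<Rightarrow> real \<Rightarrow> real^'n \<Rightarrow> real^'n \<Rightarrow> real \<Rightarrow> bool" where
  "wolfe f G c1 c2 z d a \<longleftrightarrow>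
     a > 0 \<and>
     f (z + a *\<^sub>R d) \<le> f z + c1 * a * (G z \<bullet> d) \<and>
     G (z + a *\<^sub>R d) \<bullet> d \<ge> c2 * (G z \<bullet> d)"

text \<open>
  All vectors \<open>B y\<close>, where the columns of the matrix \<open>B\<close> are the gradient at \<open>x j\<close>, the
  direction \<open>d\<close> and, for every \<open>p \<in> P\<close>, the vector \<open>q\<^sub>p\<close> and the difference of \<open>x j\<close>
  and the first iterate of the block. The coefficients \<open>a\<close>, \<open>b\<close>, \<open>c p\<close>, \<open>e p\<close> are the
  entries of \<open>y\<close>. (In a run of the algorithm \<open>P\<close> is finite.)
\<close>

definition correction_space ::
    "(real^'n \<Rightarrow> real) \<Rightarrow> (real^'n \<Rightarrow> real^'n) \<Rightarrow> (nat \<Rightarrow> real^'n) \<Rightarrow> nat set \<Rightarrow> real^'n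
      \<Rightarrow> nat \<Rightarrow> (real^'n) set" where
  "correction_space f G x P d j =
     {a *\<^sub>R G (x j) + b *\<^sub>R d
        + (\<Sum>p\<in>P. c p *\<^sub>R (\<Sum>i\<in>{block_start j p..<j}. lam f G x i *\<^sub>R G (x i))
               + e p *\<^sub>R (x j - x (block_start j p)))
      | a b c e. True}"

text \<open>
  A run of the algorithm with line search constants \<open>c1\<close>, \<open>c2\<close>. At iteration \<open>j\<close>,
  \<open>S j\<close> is the set of active exponents, \<open>d j\<close>, \<open>\<beta> j\<close>, \<open>\<alpha> j\<close> are the conjugate gradient
  direction, its parameter and the step length, \<open>s j\<close> is the step taken, \<open>\<mu> j u\<close> is the
  value used in the verification of the trial step \<open>u\<close> for the weight not yet available, and
  \<open>\<epsilon> j\<close> is the accuracy to which the subspace problem is solved in a correction step. No rule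
  for \<open>\<beta>\<close>, \<open>\<mu>\<close>, \<open>\<epsilon>\<close> is prescribed. The last conjunct is what verification guarantees:
  the inequalities, with the true weights, for every block throughout which its exponent is
  active.
\<close>

definition cgso_run ::
    "(real^'n \<Rightarrow> real) \<Rightarrow> (real^'n \<Rightarrow> real^'n) \<Rightarrow> real \<Rightarrow> real \<Rightarrow> real
      \<Rightarrow> (nat \<Rightarrow> real^'n \<Rightarrow> real) \<Rightarrow> (nat \<Rightarrow> real)
      \<Rightarrow> (nat \<Rightarrow> nat set) \<Rightarrow> (nat \<Rightarrow> real) \<Rightarrow> (nat \<Rightarrow> real^'n) \<Rightarrow> (nat \<Rightarrow> real)
      \<Rightarrow> (nat \<Rightarrow> real^'n) \<Rightarrow> (nat \<Rightarrow> real^'n) \<Rightarrow> bool" where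
  "cgso_run f G \<rho> c1 c2 \<mu> \<epsilon> S \<beta> d \<alpha> s x \<longleftrightarrow>
     0 < c1 \<and> c1 < c2 \<and> c2 < 1 \<and>
     (\<forall>j u. \<mu> j u \<ge> 0) \<and> (\<forall>j. \<epsilon> j \<ge> 0) \<and>
     d 0 = - G (x 0) \<and>
     (\<forall>j. d (Suc j) = - G (x (Suc j)) + \<beta> (Suc j) *\<^sub>R d j) \<and>
     (\<forall>j. \<not> passes f G \<rho> (\<mu> j (\<alpha> j *\<^sub>R d j)) x (S j) j (\<alpha> j *\<^sub>R d j) \<longrightarrow> \<beta> (Suc j) = 0) \<and>
     (\<forall>j. wolfe f G c1 c2 (x j) (d j) (\<alpha> j)) \<and>
     (\<forall>j. if passes f G \<rho> (\<mu> j (\<alpha> j *\<^sub>R d j)) x (S j) j (\<alpha> j *\<^sub>R d j)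
          then s j = \<alpha> j *\<^sub>R d j
          else s j \<in> correction_space f G x (S j) (d j) j \<and>
               (\<forall>u \<in> correction_space f G x (S j) (d j) j. f (x j + s j) \<le> f (x j + u) + \<epsilon> j) \<and>
               passes f G \<rho> (\<mu> j (s j)) x (S j) j (s j)) \<and>
     (\<forall>j. x (Suc j) = x j + s j) \<and>
     S 0 = {} \<and>
     (\<forall>j. S (Suc j) =
        {p. p \<ge> 4 \<and>
            (if 2 ^ p dvd Suc j
             then p \<notin> S j \<and> \<not> independent f G \<rho> (lam f G x) x (Suc j - 2 ^ p) j
             else p \<in> S j)}) \<and>
     (\<forall>p r. p \<ge> 4 \<and> 2 ^ p dvd r \<and> (\<forall>j\<in>{r..r + 2 ^ p - 1}. p \<in> S j) \<longrightarrow>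
        independent f G \<rho> (lam f G x) x r (r + 2 ^ p - 1))"

definition cgso_sequence ::
    "(real^'n \<Rightarrow> real) \<Rightarrow> (real^'n \<Rightarrow> real^'n) \<Rightarrow> real \<Rightarrow> (nat \<Rightarrow> real^'n) \<Rightarrow> bool" where
  "cgso_sequence f G \<rho> x \<longleftrightarrow>
     (\<exists>c1 c2 \<mu> \<epsilon> S \<beta> d \<alpha> s. cgso_run f G \<rho> c1 c2 \<mu> \<epsilon> S \<beta> d \<alpha> s x)"

end

theory Submission imports Defs begin

text \<open>
  Two effects combine. Let \<open>v\<close> be the residual along the iterates and \<open>\<kappa> = sqrt (L / l)\<close>.

  An independent block of more than \<open>4 * \<rho> * \<kappa>\<close> iterates halves \<open>v\<close>
  (\<open>independent_block_halves_residual\<close>). Convexity at each iterate and (I1) together bound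
  the inner product of \<open>\<Sum>i. \<lambda>\<^sub>i g\<^sub>i\<close> with \<open>x\<^sub>r - x\<^sup>*\<close> from below by a fixed
  fraction of \<open>v\<^sub>r * (\<Sum>i. \<lambda>\<^sub>i)\<close>, as long as \<open>v\<close> has not been halved. From above, it is
  controlled by the Cauchy-Schwarz inequality, (I2), and the fact that
  \<open>\<lambda>\<^sub>i\<^sup>2 * \<parallel>g\<^sub>i\<parallel>\<^sup>2\<close> is the decrease of \<open>f\<close> in step \<open>i\<close>, so that the sum in (I2)
  telescopes. The weights are at least \<open>1 / sqrt (2 * L)\<close>, so the lower bound grows with the
  length of the block while the upper bound does not.

  Such a block is always near: an exponent is inactive during a block that is not
  independent, hence gets activated, and correction makes the next block independent
  (\<open>one_of_two_blocks_independent\<close>). For \<open>m \<ge> 16\<close>, take the power of two with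
  \<open>2 ^ p \<le> m < 2 ^ (p + 1)\<close>. Two consecutive blocks of size \<open>2 ^ p\<close> fit between the
  indices \<open>n * m\<close> and \<open>n * m + 3 * m\<close>, and \<open>2 ^ p > m / 2 \<ge> 4 * \<rho> * \<kappa>\<close>.

  For \<open>m < 16\<close> the blocks may be too long for the available iterations, since the smallest
  ones have size \<open>16\<close>. But then \<open>L / l < 4\<close>, and three steps suffice by the linear
  rate \<open>1 - l / L\<close> of any method with this descent (\<open>residual_linear_rate\<close>).
\<close>

section \<open>Descent sequences of strongly convex functions\<close>

locale strongly_convex_descent =
  fixes f :: "real^'n \<Rightarrow> real" and G :: "real^'n \<Rightarrow> real^'n"
    and L l :: real and xstar :: "real^'n" and x :: "nat \<Rightarrow> real^'n"
  assumes gderiv: "\<And>z. GDERIV f z :> G z"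
    and convex: "strongly_convex f G L l (x 0)"
    and minimizer: "\<And>z. f xstar \<le> f z"
    and decrease: "\<And>j. f (x (Suc j)) \<le> f (x j) - 1 / (2 * L) * (norm (G (x j)))\<^sup>2"
    and gradient_nonzero: "\<And>j. G (x j) \<noteq> 0"
begin

abbreviation v :: "nat \<Rightarrow> real" where
  "v j \<equiv> residual f xstar (x j)"

lemma L_pos: "L > 0" and l_pos: "l > 0"
  using convex by (auto simp: strongly_convex_def)

lemma value_antimono: "i \<le> j \<Longrightarrow> f (x j) \<le> f (x i)"
proof (rule lift_Suc_antimono_le[of "\<lambda>j. f (x j)"])
  show "f (x (Suc j)) \<le> f (x j)" for j
    using decrease[of j] L_pos by (smt (verit) divide_nonneg_pos mult_nonneg_nonneg zero_le_power2)
qed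

lemma residual_antimono: "i \<le> j \<Longrightarrow> v j \<le> v i"
  using value_antimono by (simp add: residual_def)

lemma residual_nonneg: "v j \<ge> 0"
  using minimizer by (simp add: residual_def)

lemma residual_pos: "v j > 0"
proof -
  have "1 / (2 * L) * (norm (G (x j)))\<^sup>2 > 0"
    using L_pos gradient_nonzero[of j] by simp
  then show ?thesis
    using decrease[of j] residual_nonneg[of "Suc j"] by (simp add: residual_def)
qed

lemma strong_convexity:
  assumes "f u \<le> f (x 0)" "f w \<le> f (x 0)"
  shows "f w - f u \<ge> G u \<bullet> (w - u) + l / 2 * (norm (w - u))\<^sup>2"
  using convex assms by (simp add: strongly_convex_def)

lemma gradient_minimizer: "G xstar = 0"
proof -
  have "(f has_derivative (\<lambda>h. h \<bullet> G xstar)) (at xstar)"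
    using gderiv by (simp add: gderiv_def)
  then have "(\<lambda>h. h \<bullet> G xstar) = (\<lambda>h. 0)"
    by (intro differential_zero_maxmin[of xstar UNIV f]) (use minimizer in auto)
  then show ?thesis
    by (metis inner_eq_zero_iff)
qed

lemma residual_quadratic_growth: "(norm (x j - xstar))\<^sup>2 \<le> 2 * v j / l"
  using strong_convexity[of xstar "x j"] minimizer value_antimono[of 0 j] l_pos
  by (simp add: gradient_minimizer residual_def field_simps)

lemma residual_le_inner: "v j \<le> G (x j) \<bullet> (x j - xstar)"
proof -
  have "l / 2 * (norm (xstar - x j))\<^sup>2 \<ge> 0"
    using l_pos by simp
  then show ?thesis
    using strong_convexity[of "x j" xstar] minimizer[of "x 0"] value_antimono[of 0 j]
    by (simp add: residual_def inner_diff_right)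
qed

text \<open>
  Minimizing the quadratic lower model of strong convexity over all displacements; the
  estimate is a completed square in \<open>G (x j) + l *\<^sub>R (xstar - x j)\<close>.
\<close>
lemma gradient_dominates_residual: "2 * l * v j \<le> (norm (G (x j)))\<^sup>2"
proof -
  define h where "h = xstar - x j"
  have "- v j \<ge> G (x j) \<bullet> h + l / 2 * (norm h)\<^sup>2"
    using strong_convexity[of "x j" xstar] minimizer[of "x 0"] value_antimono[of 0 j]
    by (simp add: residual_def h_def)
  then have "2 * l * (G (x j) \<bullet> h + l / 2 * (norm h)\<^sup>2) \<le> 2 * l * (- v j)"
    by (rule mult_left_mono) (use l_pos in simp)
  moreover have "0 \<le> (norm (G (x j) + l *\<^sub>R h))\<^sup>2"
    by simp
  moreover have "(norm (G (x j) + l *\<^sub>R h))\<^sup>2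
      = (norm (G (x j)))\<^sup>2 + 2 * l * (G (x j) \<bullet> h + l / 2 * (norm h)\<^sup>2)"
    by (simp add: power2_norm_eq_inner inner_add_left inner_add_right inner_commute
        algebra_simps)
  ultimately show ?thesis
    by simp
qed

lemma residual_linear_rate: "v (Suc j) \<le> (1 - l / L) * v j"
proof -
  have "2 * l * v j / (2 * L) \<le> (norm (G (x j)))\<^sup>2 / (2 * L)"
    using gradient_dominates_residual[of j] L_pos by (intro divide_right_mono) auto
  moreover have "v (Suc j) \<le> v j - (norm (G (x j)))\<^sup>2 / (2 * L)"
    using decrease[of j] by (simp add: residual_def)
  moreover have "2 * l * v j / (2 * L) = l / L * v j"
    by simp
  ultimately show ?thesis
    by (simp add: left_diff_distrib)
qed

lemma three_steps_halve_residual: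
  assumes "L / l < 4"
  shows "v (k + 3) \<le> v k / 2"
proof -
  have step: "v (Suc j) \<le> 3 / 4 * v j" for j
  proof -
    have "(1 - l / L) * v j \<le> 3 / 4 * v j"
      using assms L_pos l_pos residual_nonneg[of j]
      by (intro mult_right_mono) (auto simp: field_simps)
    then show ?thesis
      using residual_linear_rate[of j] by linarith
  qed
  have "v (k + 3) \<le> 27 / 64 * v k"
    using step[of k] step[of "Suc k"] step[of "Suc (Suc k)"] by (simp add: numeral_3_eq_3)
  then show ?thesis
    using residual_nonneg[of k] by linarith
qed

section \<open>Progress on an independent block\<close>

lemma lam_sq_gradient_sq:
  "(lam f G x j)\<^sup>2 * (norm (G (x j)))\<^sup>2 = f (x j) - f (x (Suc j))"
  using gradient_nonzero[of j] value_antimono[of j "Suc j"] by (simp add: lam_def)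

lemma lam_lower_bound: "lam f G x j \<ge> 1 / sqrt (2 * L)"
proof -
  have "1 / (2 * L) \<le> (f (x j) - f (x (Suc j))) / (norm (G (x j)))\<^sup>2"
    using decrease[of j] gradient_nonzero[of j] by (simp add: pos_le_divide_eq)
  then show ?thesis
    unfolding lam_def by (metis real_sqrt_divide real_sqrt_le_iff real_sqrt_one)
qed

lemma lam_nonneg: "lam f G x j \<ge> 0"
  using lam_lower_bound[of j] L_pos by (meson divide_nonneg_nonneg order_trans real_sqrt_ge_zero
      less_imp_le zero_le_one mult_nonneg_nonneg zero_le_numeral)

text \<open>
  (I1) makes up for the iterates having moved: convexity at \<open>x i\<close> involves \<open>x i - xstar\<close>, and
  (I1) replaces the weighted sum of these differences by one with the fixed vector
  \<open>x r - xstar\<close>, at the price of a quarter of the decrease over the block.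
\<close>
lemma I1_inner_lower_bound:
  assumes "I1 f G (lam f G x) x r t"
  shows "(v t - (v r - v t) / 4) * (\<Sum>i=r..t. lam f G x i)
         \<le> (\<Sum>i=r..t. lam f G x i *\<^sub>R G (x i)) \<bullet> (x r - xstar)"
proof -
  let ?la = "lam f G x"
  have "?la i * v t \<le> ?la i * (G (x i) \<bullet> (x i - x r)) + (?la i *\<^sub>R G (x i)) \<bullet> (x r - xstar)"
    if "i \<in> {r..t}" for i
  proof -
    have "v t \<le> G (x i) \<bullet> (x i - xstar)"
      using residual_le_inner[of i] residual_antimono[of i t] that by simp
    also have "\<dots> = G (x i) \<bullet> (x i - x r) + G (x i) \<bullet> (x r - xstar)"
      by (simp add: inner_diff_right)
    finally have "?la i * v t \<le> ?la i * (G (x i) \<bullet> (x i - x r) + G (x i) \<bullet> (x r - xstar))"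
      by (rule mult_left_mono) (rule lam_nonneg)
    then show ?thesis
      by (simp add: distrib_left)
  qed
  then have "(\<Sum>i=r..t. ?la i * v t)
      \<le> (\<Sum>i=r..t. ?la i * (G (x i) \<bullet> (x i - x r)) + (?la i *\<^sub>R G (x i)) \<bullet> (x r - xstar))"
    by (rule sum_mono)
  then have "v t * (\<Sum>i=r..t. ?la i) \<le> (\<Sum>i=r..t. ?la i * (G (x i) \<bullet> (x i - x r)))
      + (\<Sum>i=r..t. ?la i *\<^sub>R G (x i)) \<bullet> (x r - xstar)"
    by (simp add: sum.distrib inner_sum_left sum_distrib_left mult.commute)
  then show ?thesis
    using assms by (simp add: I1_def residual_def algebra_simps diff_divide_distrib)
qed

lemma I2_norm_upper_bound:
  assumes "r \<le> t" and "I2 G \<rho> (lam f G x) x r t"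
  shows "norm (\<Sum>i=r..t. lam f G x i *\<^sub>R G (x i)) \<le> \<rho> * sqrt (v r - v (Suc t))"
proof -
  have "(\<Sum>i=r..t. (lam f G x i)\<^sup>2 * (norm (G (x i)))\<^sup>2) = (\<Sum>i=r..t. f (x i) - f (x (Suc i)))"
    by (simp add: lam_sq_gradient_sq)
  also have "\<dots> = v r - v (Suc t)"
    using sum_Suc_diff[of r t "\<lambda>i. - f (x i)"] assms(1) by (simp add: residual_def)
  finally show ?thesis
    using assms(2) by (simp add: I2_def)
qed

text \<open>
  If \<open>v\<close> is more than half its initial value at the end, the coefficient in
  \<open>I1_inner_lower_bound\<close> exceeds \<open>3 / 8 * v r\<close> and the decrease in \<open>I2_norm_upper_bound\<close> is
  less than \<open>v r / 2\<close>. Dividing by \<open>v r\<close> leaves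
  \<open>length \<le> 8 * sqrt 2 / 3 * \<rho> * sqrt (L / l)\<close>, and \<open>8 * sqrt 2 / 3 < 4\<close>.
\<close>
lemma independent_block_halves_residual:
  assumes "r \<le> t" and "\<rho> > 0" and "independent f G \<rho> (lam f G x) x r t"
    and long: "4 * \<rho> * sqrt (L / l) < real (Suc t - r)"
  shows "v (Suc t) \<le> v r / 2"
proof (rule ccontr)
  assume "\<not> ?thesis"
  then have slow: "v (Suc t) > v r / 2"
    by simp
  let ?\<Lambda> = "\<Sum>i=r..t. lam f G x i"
  let ?g = "\<Sum>i=r..t. lam f G x i *\<^sub>R G (x i)"
  have "v r > 0"
    by (rule residual_pos)
  have "real (Suc t - r) * (1 / sqrt (2 * L)) \<le> ?\<Lambda>"
    using sum_bounded_below[of "{r..t}" "1 / sqrt (2 * L)" "lam f G x"] lam_lower_bound by simp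
  then have "3 / 8 * v r * (real (Suc t - r) * (1 / sqrt (2 * L))) \<le> 3 / 8 * v r * ?\<Lambda>"
    using \<open>v r > 0\<close> by (intro mult_left_mono) auto
  also have "\<dots> \<le> (v t - (v r - v t) / 4) * ?\<Lambda>"
  proof (rule mult_right_mono)
    show "3 / 8 * v r \<le> v t - (v r - v t) / 4"
      using slow residual_antimono[of t "Suc t"] by (simp add: field_simps)
  qed (simp add: lam_nonneg sum_nonneg)
  also have "\<dots> \<le> ?g \<bullet> (x r - xstar)"
    using I1_inner_lower_bound assms by (simp add: independent_def)
  also have "\<dots> \<le> norm ?g * norm (x r - xstar)"
    by (rule norm_cauchy_schwarz)
  also have "\<dots> \<le> (\<rho> * sqrt (v r / 2)) * sqrt (2 * v r / l)"
  proof (rule mult_mono)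
    have "norm ?g \<le> \<rho> * sqrt (v r - v (Suc t))"
      using I2_norm_upper_bound assms by (simp add: independent_def)
    also have "\<dots> \<le> \<rho> * sqrt (v r / 2)"
      using slow \<open>\<rho> > 0\<close> by simp
    finally show "norm ?g \<le> \<rho> * sqrt (v r / 2)" .
    show "norm (x r - xstar) \<le> sqrt (2 * v r / l)"
      by (rule real_le_rsqrt) (rule residual_quadratic_growth)
  qed (use \<open>\<rho> > 0\<close> \<open>v r > 0\<close> in auto)
  also have "\<dots> = \<rho> * (v r / sqrt l)"
    using \<open>v r > 0\<close> by (simp add: real_sqrt_divide real_sqrt_mult)
  finally have "v r * (3 / 8 * real (Suc t - r) / sqrt (2 * L)) \<le> v r * (\<rho> / sqrt l)"
    by (simp add: mult_ac)
  then have "3 / 8 * real (Suc t - r) / sqrt (2 * L) \<le> \<rho> / sqrt l"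
    using \<open>v r > 0\<close> by (rule mult_left_le_imp_le)
  then have "3 / 8 * real (Suc t - r) \<le> \<rho> / sqrt l * sqrt (2 * L)"
    using L_pos by (subst (asm) pos_divide_le_eq) auto
  also have "\<dots> = sqrt 2 * (\<rho> * sqrt (L / l))"
    by (simp add: real_sqrt_mult real_sqrt_divide)
  also have "\<dots> \<le> 3 / 2 * (\<rho> * sqrt (L / l))"
    using \<open>\<rho> > 0\<close> L_pos l_pos
    by (intro mult_right_mono real_le_lsqrt) (auto simp: power2_eq_square)
  finally show False
    using long by simp
qed

end

section \<open>Occurrence of independent blocks\<close>

lemma cgso_run_active_Suc:
  assumes "cgso_run f G \<rho> c1 c2 \<mu> \<epsilon> S \<beta> d \<alpha> s x"
  shows "p \<in> S (Suc j) \<longleftrightarrow> p \<ge> 4 \<and>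
           (if 2 ^ p dvd Suc j
            then p \<notin> S j \<and> \<not> independent f G \<rho> (lam f G x) x (Suc j - 2 ^ p) j
            else p \<in> S j)"
proof -
  have "\<forall>j. S (Suc j) = {p. p \<ge> 4 \<and>
      (if 2 ^ p dvd Suc j
       then p \<notin> S j \<and> \<not> independent f G \<rho> (lam f G x) x (Suc j - 2 ^ p) j
       else p \<in> S j)}"
    using assms unfolding cgso_run_def by (elim conjE) assumption
  then show ?thesis
    by simp
qed

lemma cgso_run_corrected_block:
  assumes "cgso_run f G \<rho> c1 c2 \<mu> \<epsilon> S \<beta> d \<alpha> s x"
    and "p \<ge> 4" and "2 ^ p dvd r" and "\<And>j. j \<in> {r..r + 2 ^ p - 1} \<Longrightarrow> p \<in> S j"
  shows "independent f G \<rho> (lam f G x) x r (r + 2 ^ p - 1)"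
proof -
  have "\<forall>p r. p \<ge> 4 \<and> 2 ^ p dvd r \<and> (\<forall>j\<in>{r..r + 2 ^ p - 1}. p \<in> S j) \<longrightarrow>
      independent f G \<rho> (lam f G x) x r (r + 2 ^ p - 1)"
    using assms(1) unfolding cgso_run_def by (elim conjE) assumption
  from this[rule_format, of p r] show ?thesis
    using assms(2-4) by blast
qed

text \<open>
  An update of the active set changes the status of \<open>p\<close> only at a multiple of \<open>2 ^ p\<close>, and
  no index strictly inside a block is one.
\<close>
lemma active_constant_on_block:
  assumes run: "cgso_run f G \<rho> c1 c2 \<mu> \<epsilon> S \<beta> d \<alpha> s x"
    and "p \<ge> 4" and "2 ^ p dvd r" and "k < 2 ^ p"
  shows "p \<in> S (r + k) \<longleftrightarrow> p \<in> S r"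
  using \<open>k < 2 ^ p\<close>
proof (induction k)
  case (Suc k)
  have "\<not> 2 ^ p dvd Suc (r + k)"
    using Suc.prems \<open>2 ^ p dvd r\<close> dvd_add_right_iff[of "2 ^ p" r "Suc k"]
    by (auto dest: dvd_imp_le)
  then show ?case
    using cgso_run_active_Suc[OF run, of p "r + k"] Suc \<open>p \<ge> 4\<close> by simp
qed simp

text \<open>
  If the first block is not independent, then \<open>p\<close> was inactive on it, since correction would
  have made it independent. So the test at its end activates \<open>p\<close> instead of removing it, and
  \<open>p\<close> stays active for all of the second block.
\<close>
lemma one_of_two_blocks_independent:
  assumes "cgso_sequence f G \<rho> x" and "p \<ge> 4" and "2 ^ p dvd r"
  shows "independent f G \<rho> (lam f G x) x r (r + 2 ^ p - 1)
       \<or> independent f G \<rho> (lam f G x) x (r + 2 ^ p) (r + 2 ^ p + 2 ^ p - 1)"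
proof (rule disj_imp[THEN iffD2], rule impI)
  assume dependent: "\<not> independent f G \<rho> (lam f G x) x r (r + 2 ^ p - 1)"
  obtain c1 c2 \<mu> \<epsilon> S \<beta> d \<alpha> s where run: "cgso_run f G \<rho> c1 c2 \<mu> \<epsilon> S \<beta> d \<alpha> s x"
    using assms(1) by (auto simp: cgso_sequence_def)
  have corrected: "independent f G \<rho> (lam f G x) x q (q + 2 ^ p - 1)"
    if "2 ^ p dvd q" and "p \<in> S q" for q
  proof -
    have "p \<in> S j" if "j \<in> {q..q + 2 ^ p - 1}" for j
    proof -
      have "j - q < 2 ^ p" "j = q + (j - q)"
        using that one_le_power[of "2 :: nat" p] unfolding atLeastAtMost_iff by linarith+
      then show ?thesis
        using active_constant_on_block[OF run \<open>p \<ge> 4\<close> \<open>2 ^ p dvd q\<close>, of "j - q"] \<open>p \<in> S q\<close>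
        by simp
    qed
    then show ?thesis
      by (rule cgso_run_corrected_block[OF run \<open>p \<ge> 4\<close> \<open>2 ^ p dvd q\<close>])
  qed
  have "p \<notin> S r"
    using corrected[of r] dependent assms(3) by blast
  then have inactive: "p \<notin> S (r + 2 ^ p - 1)"
    using active_constant_on_block[OF run assms(2,3), of "2 ^ p - 1"] by simp
  define j where "j = r + 2 ^ p - 1"
  have Suc_j: "Suc j = r + 2 ^ p"
    by (simp add: j_def)
  have "2 ^ p dvd Suc j" "Suc j - 2 ^ p = r"
    using Suc_j assms(3) by simp_all
  then have "p \<in> S (Suc j)"
    using cgso_run_active_Suc[OF run, of p j] inactive dependent \<open>p \<ge> 4\<close>
    unfolding j_def[symmetric] by simp
  then have "p \<in> S (r + 2 ^ p)"
    by (simp add: Suc_j)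
  then show "independent f G \<rho> (lam f G x) x (r + 2 ^ p) (r + 2 ^ p + 2 ^ p - 1)"
    using corrected[of "r + 2 ^ p"] assms(3) by simp
qed

lemma independent_block_in_window:
  assumes "cgso_sequence f G \<rho> x" and "p \<ge> 4"
  obtains r where "a \<le> r" and "r + 2 ^ p \<le> a + 3 * 2 ^ p"
    and "independent f G \<rho> (lam f G x) x r (r + 2 ^ p - 1)"
proof -
  \<comment> \<open>the first multiple of the block size that is at least \<open>a\<close>\<close>
  define q where "q = 2 ^ p * ((a + 2 ^ p - 1) div 2 ^ p)"
  have "q + (a + 2 ^ p - 1) mod 2 ^ p = a + 2 ^ p - 1"
    by (simp add: q_def)
  moreover have "(a + 2 ^ p - 1) mod 2 ^ p < (2 ^ p :: nat)"
    by simp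
  ultimately have q: "a \<le> q" "q \<le> a + 2 ^ p"
    by linarith+
  have "2 ^ p dvd q"
    by (simp add: q_def)
  then consider "independent f G \<rho> (lam f G x) x q (q + 2 ^ p - 1)"
    | "independent f G \<rho> (lam f G x) x (q + 2 ^ p) (q + 2 ^ p + 2 ^ p - 1)"
    using one_of_two_blocks_independent[OF assms] by blast
  then show ?thesis
  proof cases
    case 1
    show ?thesis
      by (rule that[OF _ _ 1]) (use q in linarith)+
  next
    case 2
    show ?thesis
      by (rule that[OF _ _ 2]) (use q in linarith)+
  qed
qed

section \<open>Halving of the residual\<close>

theorem theorem1:
  fixes f :: "real^'n \<Rightarrow> real" and G :: "real^'n \<Rightarrow> real^'n"
    and L l \<rho> :: real and xstar :: "real^'n" and x :: "nat \<Rightarrow> real^'n" and m n :: nat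
  assumes "\<And>z. GDERIV f z :> G z"
    and "strongly_convex f G L l (x 0)"
    and "\<And>z. f xstar \<le> f z"
    and "\<rho> \<ge> 1"
    and "cgso_sequence f G \<rho> x"
    and "\<And>j. f (x (Suc j)) \<le> f (x j) - 1 / (2 * L) * (norm (G (x j)))\<^sup>2"
    and "\<And>j. G (x j) \<noteq> 0"
    and "int m \<ge> \<lceil>8 * \<rho> * sqrt (L / l)\<rceil>"
  shows "residual f xstar (x ((n + 4) * m)) \<le> 1 / 2 * residual f xstar (x (n * m))"
proof -
  interpret strongly_convex_descent f G L l xstar x
    by unfold_locales (use assms in auto)
  have m: "8 * \<rho> * sqrt (L / l) \<le> real m"
    using assms(8) by (simp add: ceiling_le_iff)
  have kappa_pos: "sqrt (L / l) > 0"
    using L_pos l_pos by simp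
  have "8 * 1 * sqrt (L / l) \<le> 8 * \<rho> * sqrt (L / l)"
    using \<open>\<rho> \<ge> 1\<close> kappa_pos by (intro mult_right_mono) auto
  then have kappa: "8 * sqrt (L / l) \<le> real m"
    using m by linarith
  then have "m \<ge> 1"
    using kappa_pos by (cases m) auto
  \<comment> \<open>the residual does not increase, so halving between any two indices of the window suffices\<close>
  obtain i k where "n * m \<le> i" "k \<le> (n + 4) * m" and "v k \<le> v i / 2"
  proof (cases "m < 16")
    case True
    then have "sqrt (L / l) < 2"
      using kappa by linarith
    then have "L / l < 4"
      using real_less_lsqrt real_sqrt_less_iff[of "L / l" 4] by simp
    then have "v (n * m + 3) \<le> v (n * m) / 2"
      by (rule three_steps_halve_residual)
    then show ?thesis
      using that[of "n * m" "n * m + 3"] \<open>m \<ge> 1\<close> by (simp add: distrib_right)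
  next
    case False
    obtain p where p: "2 ^ p \<le> m" "m < 2 ^ (p + 1)"
      using ex_power_ivl1[OF order.refl \<open>m \<ge> 1\<close>] by (elim exE conjE)
    have "(2::nat) ^ 4 < 2 ^ (p + 1)"
      using False p(2) by simp
    then have "p \<ge> 4"
      by (subst (asm) power_strict_increasing_iff) auto
    then obtain r where r: "n * m \<le> r" "r + 2 ^ p \<le> n * m + 3 * 2 ^ p"
      and block: "independent f G \<rho> (lam f G x) x r (r + 2 ^ p - 1)"
      by (rule independent_block_in_window[OF assms(5), where a = "n * m"])
    have "real m < real (2 ^ (p + 1))"
      using p(2) by (subst of_nat_less_iff)
    then have "real m < 2 * 2 ^ p"
      by simp
    then have "4 * \<rho> * sqrt (L / l) < 2 ^ p"
      using m by linarith
    moreover have "r \<le> r + 2 ^ p - 1"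
      using one_le_power[of "2 :: nat" p] by linarith
    ultimately have "v (Suc (r + 2 ^ p - 1)) \<le> v r / 2"
      using block \<open>\<rho> \<ge> 1\<close> by (intro independent_block_halves_residual) auto
    moreover have "r + 2 ^ p \<le> (n + 4) * m"
      using r(2) p(1) by (simp add: distrib_right)
    ultimately show ?thesis
      using that[of r "r + 2 ^ p"] r(1) by simp
  qed
  have "v ((n + 4) * m) \<le> v k"
    using \<open>k \<le> (n + 4) * m\<close> by (rule residual_antimono)
  also have "\<dots> \<le> v i / 2"
    by fact
  also have "\<dots> \<le> 1 / 2 * v (n * m)"
    using residual_antimono[OF \<open>n * m \<le> i\<close>] by simp
  finally show ?thesis .
qed

end
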